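(* The exponential generating function of the permutations avoiding the partially ordered generalized pattern $3$-$121$-$3$ is $$\sum_{n\ge0} c_n\frac{x^n}{n!}=1+\int\exp\left(\frac{e^{2x}+2x-1}{2}\right)dx,$$ where $c_n$ is the number of permutations in $\mathcal{S}_n$ avoiding $3$-$121$-$3$.
   Context: $\mathcal{S}_n$ is the set of permutations of $\{1,\dots,n\}$, written as words $a_1\dots a_n$ (for $n=0$, the empty permutation). A partially ordered generalized pattern is a word $p_1p_2\dots p_m$ of positive integers (repetitions allowed) with a dash written between some of the consecutive letters. An occurrence of it in $\pi=a_1\dots a_n$ is a subsequence $a_{k_1}\dots a_{k_m}$, $k_1<\dots<k_m$, such that (a) $p_i>p_j$ implies $a_{k_i}>a_{k_j}$ for all $i,j$ (no condition when $p_i=p_j$), and (b) $k_{i+1}=k_i+1$ whenever $p_i$ and $p_{i+1}$ are not separated by a dash. $\pi$ avoids the pattern if it has no occurrence. The formal integral of a power series is $\int\sum_{n\ge0} f_nx^n\,dx=\sum_{n\ge0} f_n\frac{x^{n+1}}{n+1}$. *)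

theory Defs
  imports
    "HOL-Combinatorics.Multiset_Permutations"
    "HOL-Computational_Algebra.Formal_Power_Series"
begin

text \<open>
  A partially ordered generalized pattern is a word of positive integers together with a set
  of dash positions: \<open>i \<in> dashes P\<close> means that a dash is written between the letters with
  indices \<open>i\<close> and \<open>i + 1\<close>. Words are lists and indices start at 0. Permutations of
  \<open>{1..n}\<close>, as words, are the elements of \<^term>\<open>permutations_of_set {1..n}\<close>.
\<close>

record pogp =
  letters :: "nat list"
  dashes :: "nat set"

text \<open>The index sequence \<open>k\<close> matters only on \<open>{..<length (letters P)}\<close>.\<close>

definition pogp_occurrence :: "pogp \<Rightarrow> nat list \<Rightarrow> (nat \<Rightarrow> nat) \<Rightarrow> bool" where
  "pogp_occurrence P a k \<longleftrightarrow>
     (let p = letters P; m = length p in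
       strict_mono_on {..<m} k \<and>
       k ` {..<m} \<subseteq> {..<length a} \<and>
       (\<forall>i<m. \<forall>j<m. p ! i > p ! j \<longrightarrow> a ! k i > a ! k j) \<and>
       (\<forall>i. i + 1 < m \<and> i \<notin> dashes P \<longrightarrow> k (i + 1) = k i + 1))"

definition pogp_avoids :: "nat list \<Rightarrow> pogp \<Rightarrow> bool" where
  "pogp_avoids a P \<longleftrightarrow> \<not> (\<exists>k. pogp_occurrence P a k)"

definition num_avoiding :: "pogp \<Rightarrow> nat \<Rightarrow> nat" where
  "num_avoiding P n = card {a \<in> permutations_of_set {1..n}. pogp_avoids a P}"

definition pattern_3_121_3 :: pogp where
  "pattern_3_121_3 = \<lparr>letters = [3, 1, 2, 1, 3], dashes = {0, 3}\<rparr>"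

end

theory Submission
  imports Defs
begin

text \<open>
  An occurrence of 3-121-3 is an interior peak with a larger letter on each side. Split a
  permutation at its maximum: the maximum supplies the larger letter on the right for the
  peaks of the left part and on the left for those of the right part. Keeping two flags that
  say whether such an outer larger letter is already present on the left or on the right gives
  a recurrence closed under this splitting. For the exponential generating functions
  \<open>E\<^bsub>lr\<^esub>\<close> it reads \<open>E\<^bsub>lr\<^esub>' = E\<^bsub>l1\<^esub> E\<^bsub>1r\<^esub>\<close> unless \<open>l = r = 1\<close>, while
  \<open>E\<^bsub>11\<^esub> = (exp(2x) + 1) / 2\<close> counts permutations without interior peaks. Hence
  \<open>E\<^bsub>00\<^esub>' = E\<^bsub>01\<^esub> E\<^bsub>10\<^esub>\<close> solves the linear equation \<open>y' = 2 E\<^bsub>11\<^esub> y\<close>.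
\<close>

text \<open>
  The peak is at index \<open>i + 1\<close>. The flags \<open>l\<close> and \<open>r\<close> stand for a larger letter outside of
  the word, on its left and on its right.
\<close>

definition covered_peak :: "bool \<Rightarrow> bool \<Rightarrow> 'a::linorder list \<Rightarrow> nat \<Rightarrow> bool" where
  "covered_peak l r xs i \<longleftrightarrow>
     i + 2 < length xs \<and> xs ! i < xs ! (i + 1) \<and> xs ! (i + 2) < xs ! (i + 1) \<and>
     (l \<or> (\<exists>a\<in>set (take i xs). xs ! (i + 1) < a)) \<and>
     (r \<or> (\<exists>b\<in>set (drop (i + 3) xs). xs ! (i + 1) < b))"

definition no_covered_peak :: "bool \<Rightarrow> bool \<Rightarrow> 'a::linorder list \<Rightarrow> bool" where
  "no_covered_peak l r xs \<longleftrightarrow> (\<forall>i. \<not> covered_peak l r xs i)"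

section \<open>Occurrences of the pattern as covered peaks\<close>

lemma All_less_5: "(\<forall>i<5. P i) \<longleftrightarrow> P 0 \<and> P 1 \<and> P 2 \<and> P 3 \<and> P (4::nat)"
  by (simp add: numeral_eq_Suc All_less_Suc conj_ac)

lemma occurrence_3_121_3_iff:
  "pogp_occurrence pattern_3_121_3 a k \<longleftrightarrow>
     k 0 < k 1 \<and> k 2 = k 1 + 1 \<and> k 3 = k 1 + 2 \<and> k 3 < k 4 \<and> k 4 < length a \<and>
     a ! k 1 < a ! k 2 \<and> a ! k 3 < a ! k 2 \<and> a ! k 2 < a ! k 0 \<and> a ! k 2 < a ! k 4"
proof -
  have mono: "strict_mono_on {..<5} k \<longleftrightarrow> (\<forall>i<5. \<forall>j<5. i < j \<longrightarrow> k i < k j)"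
    by (auto simp: strict_mono_on_def)
  have range: "k ` {..<5} \<subseteq> {..<length a} \<longleftrightarrow> (\<forall>i<5. k i < length a)"
    by auto
  \<comment> \<open>\<open>i + 1 < 5\<close> is rewritten as \<open>i < 5\<close> with
    \<open>i \<noteq> 4\<close>, so that \<open>All_less_5\<close> can expand this quantifier as
    well.\<close>
  have adjacent: "(\<forall>i. i + 1 < 5 \<and> i \<notin> {0, 3} \<longrightarrow> k (i + 1) = k i + 1) \<longleftrightarrow>
      (\<forall>i<5. i \<noteq> 0 \<and> i \<noteq> 3 \<and> i \<noteq> 4 \<longrightarrow> k (i + 1) = k i + 1)"
    by (rule arg_cong[where f = All], rule ext) auto
  have pattern: "letters pattern_3_121_3 = [3, 1, 2, 1, 3]" "dashes pattern_3_121_3 = {0, 3}"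
      "length [3, 1, 2, 1, 3 :: nat] = 5"
    by (simp_all add: pattern_3_121_3_def)
  have "pogp_occurrence pattern_3_121_3 a k \<longleftrightarrow>
      (\<forall>i<5. \<forall>j<5. i < j \<longrightarrow> k i < k j) \<and> (\<forall>i<5. k i < length a) \<and>
      (\<forall>i<5. \<forall>j<5. [3, 1, 2, 1, 3] ! i > ([3, 1, 2, 1, 3] ! j :: nat) \<longrightarrow> a ! k i > a ! k j) \<and>
      (\<forall>i<5. i \<noteq> 0 \<and> i \<noteq> 3 \<and> i \<noteq> 4 \<longrightarrow> k (i + 1) = k i + 1)"
    by (simp only: pogp_occurrence_def Let_def pattern mono range adjacent)
  also have "\<dots> \<longleftrightarrow>
     k 0 < k 1 \<and> k 2 = k 1 + 1 \<and> k 3 = k 1 + 2 \<and> k 3 < k 4 \<and> k 4 < length a \<and>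
     a ! k 1 < a ! k 2 \<and> a ! k 3 < a ! k 2 \<and> a ! k 2 < a ! k 0 \<and> a ! k 2 < a ! k 4"
    unfolding All_less_5 by (auto simp: numeral_eq_Suc)
  finally show ?thesis .
qed

text \<open>The dashless block 121 is a peak, and the two letters 3 are the larger letters that
  cover it. Both flags are off because a whole permutation has nothing outside it.\<close>

lemma avoids_3_121_3_iff:
  "pogp_avoids a pattern_3_121_3 \<longleftrightarrow> no_covered_peak False False a"
proof -
  have "(\<exists>k. pogp_occurrence pattern_3_121_3 a k) \<longleftrightarrow> (\<exists>i. covered_peak False False a i)"
  proof
    assume "\<exists>k. pogp_occurrence pattern_3_121_3 a k"
    then obtain k :: "nat \<Rightarrow> nat" where k: "k 0 < k 1" "k 2 = k 1 + 1" "k 3 = k 1 + 2" "k 3 < k 4"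
        "k 4 < length a" "a ! k 1 < a ! k 2" "a ! k 3 < a ! k 2" "a ! k 2 < a ! k 0"
        "a ! k 2 < a ! k 4"
      by (auto simp: occurrence_3_121_3_iff)
    have "a ! k 0 \<in> set (take (k 1) a)"
      using k by (auto simp: in_set_conv_nth intro!: exI[of _ "k 0"])
    moreover have "a ! k 4 \<in> set (drop (k 1 + 3) a)"
      using k by (auto simp: in_set_conv_nth intro!: exI[of _ "k 4 - (k 1 + 3)"])
    ultimately have "covered_peak False False a (k 1)"
      using k unfolding covered_peak_def by auto
    then show "\<exists>i. covered_peak False False a i" ..
  next
    assume "\<exists>i. covered_peak False False a i"
    then obtain i where i: "covered_peak False False a i" ..
    then obtain p q where p: "p < i" "a ! (i + 1) < a ! p"
      and q: "q < length a - (i + 3)" "a ! (i + 1) < a ! (i + 3 + q)"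
      by (auto simp: covered_peak_def in_set_conv_nth)
    show "\<exists>k. pogp_occurrence pattern_3_121_3 a k"
      using i p q
      by (intro exI[of _ "\<lambda>n. [p, i, i + 1, i + 2, i + 3 + q] ! n"])
        (simp add: occurrence_3_121_3_iff covered_peak_def)
  qed
  then show ?thesis
    by (simp add: pogp_avoids_def no_covered_peak_def)
qed

section \<open>Splitting a word at its maximum\<close>

text \<open>All three letters lie in \<open>xs\<close>, so \<open>m\<close> comes after them and
  covers the peak on the right.\<close>

lemma covered_peak_append_max_left:
  assumes "i + 2 < length xs" "\<forall>x\<in>set xs. x < m"
  shows "covered_peak l r (xs @ m # ys) i \<longleftrightarrow> covered_peak l True xs i"
  using assms by (auto simp: covered_peak_def nth_append)

text \<open>No letter of the word exceeds \<open>m\<close>, so only the flags can cover a peak at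
  \<open>m\<close>; it is a peak as soon as it has two neighbours.\<close>

lemma covered_peak_append_max_mid:
  assumes "length xs = i + 1" "\<forall>x\<in>set xs. x < m" "\<forall>y\<in>set ys. y < m"
  shows "covered_peak l r (xs @ m # ys) i \<longleftrightarrow> ys \<noteq> [] \<and> l \<and> r"
proof -
  have "\<not> (\<exists>a\<in>set (take i xs). m < a)" "\<not> (\<exists>b\<in>set (drop 1 ys). m < b)"
    using assms by (meson in_set_takeD in_set_dropD order.asym)+
  with assms show ?thesis
    by (cases ys) (auto simp: covered_peak_def nth_append)
qed

text \<open>Here \<open>m\<close> precedes the peak and covers it on the left, whatever
  \<open>xs\<close> contains.\<close>

lemma covered_peak_append_max_right:
  assumes "\<forall>y\<in>set ys. y < m"
  shows "covered_peak l r (xs @ m # ys) (length xs + 1 + i) \<longleftrightarrow> covered_peak True r ys i"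
proof -
  have "(xs @ m # ys) ! (length xs + 1 + i) = ys ! i"
    "(xs @ m # ys) ! (length xs + 1 + i + 1) = ys ! (i + 1)"
    "(xs @ m # ys) ! (length xs + 1 + i + 2) = ys ! (i + 2)"
    by (simp_all add: nth_append)
  moreover have "take (length xs + 1 + i) (xs @ m # ys) = xs @ m # take i ys"
    by simp
  moreover have "drop (length xs + 1 + i + 3) (xs @ m # ys) = drop (i + 3) ys"
    by (simp add: eval_nat_numeral)
  moreover have "length xs + 1 + i + 2 < length (xs @ m # ys) \<longleftrightarrow> i + 2 < length ys"
    by simp
  moreover have "ys ! (i + 1) < m" if "i + 2 < length ys"
    using assms that by simp
  ultimately show ?thesis
    unfolding covered_peak_def by (simp only: set_append list.set) blast
qed

lemma no_covered_peak_append_max: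
  assumes "\<forall>x\<in>set xs. x < m" "\<forall>y\<in>set ys. y < m"
  shows "no_covered_peak l r (xs @ m # ys) \<longleftrightarrow>
    no_covered_peak l True xs \<and> no_covered_peak True r ys \<and> (l \<and> r \<longrightarrow> xs = [] \<or> ys = [])"
proof -
  have "(\<exists>i. covered_peak l r (xs @ m # ys) i) \<longleftrightarrow>
    (\<exists>i. covered_peak l True xs i) \<or> (\<exists>i. covered_peak True r ys i) \<or>
    (l \<and> r \<and> xs \<noteq> [] \<and> ys \<noteq> [])" (is "?A \<longleftrightarrow> ?B")
  proof
    assume ?A
    then obtain i where i: "covered_peak l r (xs @ m # ys) i" ..
    \<comment> \<open>The peak, at index \<open>i + 1\<close>, is before the last letter of
      \<open>xs\<close>, that last letter, \<open>m\<close>, the first letter of \<open>ys\<close>,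
      or later. The second and fourth cases are impossible, since \<open>m\<close> would be a larger
      neighbour.\<close>
    consider "i + 2 < length xs" | "i + 2 = length xs" | "length xs = i + 1" | "i = length xs"
      | "length xs + 1 \<le> i" by linarith
    then show ?B
    proof cases
      case 1
      then have "covered_peak l True xs i"
        using i covered_peak_append_max_left[OF 1 assms(1)] by simp
      then show ?thesis by blast
    next
      case 2
      have "(xs @ m # ys) ! (i + 2) = m"
        unfolding 2 by (rule nth_append_length)
      moreover have "(xs @ m # ys) ! (i + 1) = xs ! (i + 1)" "xs ! (i + 1) \<in> set xs"
        unfolding nth_append using 2 by simp_all
      ultimately show ?thesis
        using i assms(1) unfolding covered_peak_def by (metis order.asym)
    next
      case 3
      then show ?thesis using i covered_peak_append_max_mid[OF 3 assms] by auto
    next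
      case 4
      with i have "m < ys ! 0" "ys \<noteq> []"
        by (auto simp: covered_peak_def nth_append)
      with assms(2) have "ys ! 0 < m" by simp
      with \<open>m < ys ! 0\<close> show ?thesis by (simp add: less_not_sym)
    next
      case 5
      then obtain j where "i = length xs + 1 + j" using le_Suc_ex by blast
      then have "covered_peak True r ys j"
        using i covered_peak_append_max_right[OF assms(2)] by simp
      then show ?thesis by blast
    qed
  next
    assume ?B
    then consider i where "covered_peak l True xs i" | i where "covered_peak True r ys i"
      | "l \<and> r \<and> xs \<noteq> [] \<and> ys \<noteq> []" by blast
    then show ?A
    proof cases
      case 1
      then have "i + 2 < length xs" by (simp add: covered_peak_def)
      with 1 have "covered_peak l r (xs @ m # ys) i"
        using covered_peak_append_max_left[OF _ assms(1)] by simp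
      then show ?thesis ..
    next
      case 2
      then have "covered_peak l r (xs @ m # ys) (length xs + 1 + i)"
        using covered_peak_append_max_right[OF assms(2)] by simp
      then show ?thesis ..
    next
      case 3
      then have "length xs = (length xs - 1) + 1" by (cases xs) auto
      with 3 have "covered_peak l r (xs @ m # ys) (length xs - 1)"
        using covered_peak_append_max_mid[OF _ assms] by simp
      then show ?thesis ..
    qed
  qed
  then show ?thesis
    unfolding no_covered_peak_def by blast
qed

section \<open>Counting by the recurrence\<close>

text \<open>Since \<open>m\<close> occurs exactly once, it cuts the word in a unique way;
  \<open>B\<close> is the set of letters to its left.\<close>

lemma card_permutations_of_set_split:
  assumes "finite A" "m \<notin> A"
  shows "card {xs \<in> permutations_of_set (insert m A). P xs} =
    (\<Sum>B\<in>Pow A. card {(ys, zs). ys \<in> permutations_of_set B \<and>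
       zs \<in> permutations_of_set (A - B) \<and> P (ys @ m # zs)})"
proof -
  define Q where "Q B = {(ys, zs). ys \<in> permutations_of_set B \<and>
       zs \<in> permutations_of_set (A - B) \<and> P (ys @ m # zs)}" for B
  have fin: "finite (Q B)" for B
    by (rule finite_subset[of _ "permutations_of_set B \<times> permutations_of_set (A - B)"])
       (auto simp: Q_def)
  have "bij_betw (\<lambda>(ys, zs). ys @ m # zs) (\<Union>B\<in>Pow A. Q B)
     {xs \<in> permutations_of_set (insert m A). P xs}"
  proof (rule bij_betwI')
    fix p q assume "p \<in> (\<Union>B\<in>Pow A. Q B)" "q \<in> (\<Union>B\<in>Pow A. Q B)"
    then obtain ys zs ys' zs' where "p = (ys, zs)" "q = (ys', zs')"
      "m \<notin> set ys" "m \<notin> set zs" "m \<notin> set ys'" "m \<notin> set zs'"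
      using assms(2) by (fastforce simp: Q_def permutations_of_set_def)
    then show "((case p of (ys, zs) \<Rightarrow> ys @ m # zs) = (case q of (ys, zs) \<Rightarrow> ys @ m # zs)) = (p = q)"
      by (auto simp: append_Cons_eq_iff)
  next
    fix p assume "p \<in> (\<Union>B\<in>Pow A. Q B)"
    then show "(case p of (ys, zs) \<Rightarrow> ys @ m # zs) \<in> {xs \<in> permutations_of_set (insert m A). P xs}"
      using assms(2) by (auto simp: Q_def permutations_of_set_def)
  next
    fix xs assume xs: "xs \<in> {xs \<in> permutations_of_set (insert m A). P xs}"
    then have "m \<in> set xs" by (auto simp: permutations_of_set_def)
    then obtain ys zs where eq: "xs = ys @ m # zs" by (meson split_list)
    with xs assms(2) have "set ys \<union> set zs = A" "set ys \<inter> set zs = {}" "distinct ys" "distinct zs"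
      by (auto simp: permutations_of_set_def)
    then have "(ys, zs) \<in> Q (set ys)" "set ys \<in> Pow A"
      using xs eq by (auto simp: Q_def permutations_of_set_def)
    then show "\<exists>p\<in>\<Union>B\<in>Pow A. Q B. xs = (case p of (ys, zs) \<Rightarrow> ys @ m # zs)"
      using eq by (intro bexI[of _ "(ys, zs)"]) auto
  qed
  then have "card {xs \<in> permutations_of_set (insert m A). P xs} = card (\<Union>B\<in>Pow A. Q B)"
    by (simp add: bij_betw_same_card)
  also have "\<dots> = (\<Sum>B\<in>Pow A. card (Q B))"
    using assms(1) fin by (intro card_UN_disjoint) (auto simp: Q_def permutations_of_set_def)
  finally show ?thesis by (simp add: Q_def)
qed

lemma sum_Pow_card:
  fixes f :: "nat \<Rightarrow> nat"
  assumes "finite A"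
  shows "(\<Sum>B\<in>Pow A. f (card B)) = (\<Sum>k\<le>card A. (card A choose k) * f k)"
proof -
  have "(\<Sum>B\<in>Pow A. f (card B)) = (\<Sum>k\<le>card A. \<Sum>B | B \<in> Pow A \<and> card B = k. f (card B))"
    using assms by (intro sum.group[symmetric]) (auto intro: card_mono)
  also have "\<dots> = (\<Sum>k\<le>card A. (card A choose k) * f k)"
    using assms n_subsets[OF assms] by (intro sum.cong) simp_all
  finally show ?thesis .
qed

text \<open>Of the \<open>n\<close> letters below the maximum, \<open>k\<close> stand to its left.
  The zero term discards words whose maximum is itself a covered peak.\<close>

fun peak_count :: "bool \<Rightarrow> bool \<Rightarrow> nat \<Rightarrow> nat" where
  "peak_count l r 0 = 1"
| "peak_count l r (Suc n) = (\<Sum>k\<le>n. (n choose k) *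
     (if l \<and> r \<and> k \<noteq> 0 \<and> k \<noteq> n then 0 else peak_count l True k * peak_count True r (n - k)))"

text \<open>Stated for arbitrary finite sets and all flags, because the two parts around the maximum
  need not use consecutive letters and have other flags.\<close>

lemma card_no_covered_peak:
  assumes "finite S"
  shows "card {xs \<in> permutations_of_set S. no_covered_peak l r xs} = peak_count l r (card S)"
  using assms
proof (induction "card S" arbitrary: S l r rule: less_induct)
  case less
  show ?case
  proof (cases "S = {}")
    case True
    have "{xs \<in> permutations_of_set ({} :: 'a set). no_covered_peak l r xs} = {[]}"
      by (auto simp: no_covered_peak_def covered_peak_def)
    then show ?thesis using True by simp
  next
    case False
    define m where "m = Max S"
    define A where "A = S - {m}"
    have S: "S = insert m A" and A: "finite A" "m \<notin> A" "\<And>x. x \<in> A \<Longrightarrow> x < m"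
      using False less.prems by (auto simp: m_def A_def intro: le_neq_trans Max_in)
    have card_S: "card S = Suc (card A)" using S A by simp
    \<comment> \<open>The summand of the recurrence: the number of pairs depends on \<open>B\<close>
      only through its size.\<close>
    define f where "f k = (if l \<and> r \<and> k \<noteq> 0 \<and> k \<noteq> card A then 0
      else peak_count l True k * peak_count True r (card A - k))" for k
    have count: "card {(ys, zs). ys \<in> permutations_of_set B \<and> zs \<in> permutations_of_set (A - B) \<and>
       no_covered_peak l r (ys @ m # zs)} = f (card B)" (is "card ?X = _") if B: "B \<in> Pow A" for B
    proof -
      have fin: "finite B" using B A finite_subset by auto
      have cards: "card (A - B) = card A - card B" "card B \<le> card A"
        using B A fin by (auto simp: card_Diff_subset card_mono)
      have empty: "card B = card A \<longleftrightarrow> A - B = {}" "card B = 0 \<longleftrightarrow> B = {}"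
        using B A fin card_subset_eq by auto
      let ?Y = "{ys \<in> permutations_of_set B. no_covered_peak l True ys}"
      let ?Z = "{zs \<in> permutations_of_set (A - B). no_covered_peak True r zs}"
      have "?X = (if l \<and> r \<and> card B \<noteq> 0 \<and> card B \<noteq> card A then {} else ?Y \<times> ?Z)"
      proof -
        have "no_covered_peak l r (ys @ m # zs) \<longleftrightarrow> no_covered_peak l True ys \<and>
          no_covered_peak True r zs \<and> (l \<and> r \<longrightarrow> card B = 0 \<or> card B = card A)"
          if "ys \<in> permutations_of_set B" "zs \<in> permutations_of_set (A - B)" for ys zs
        proof -
          have "set ys = B" "set zs = A - B" using that by (auto simp: permutations_of_set_def)
          moreover from this have "ys = [] \<longleftrightarrow> card B = 0" "zs = [] \<longleftrightarrow> card B = card A"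
            unfolding empty set_empty[symmetric] by auto
          ultimately show ?thesis
            using B A no_covered_peak_append_max[of ys m zs l r] by auto
        qed
        then show ?thesis by auto
      qed
      moreover have "card ?Y = peak_count l True (card B)"
        using fin cards card_S by (intro less.hyps) auto
      moreover have "card ?Z = peak_count True r (card A - card B)"
        using A cards card_S less.hyps[of "A - B" True r] by auto
      ultimately show ?thesis
        by (simp add: f_def card_cartesian_product)
    qed
    have "card {xs \<in> permutations_of_set S. no_covered_peak l r xs} = (\<Sum>B\<in>Pow A. f (card B))"
      unfolding S card_permutations_of_set_split[OF A(1,2)] by (intro sum.cong refl count)
    also have "\<dots> = (\<Sum>k\<le>card A. (card A choose k) * f k)"
      by (rule sum_Pow_card[OF A(1)])
    also have "\<dots> = peak_count l r (card S)"
      unfolding card_S f_def by simp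
    finally show ?thesis .
  qed
qed

text \<open>The maximum must stand at an end, which doubles the count except for a single letter,
  where both ends coincide. Truncated subtraction gives the value 1 at \<open>n = 0\<close>.\<close>

lemma peak_count_True_True: "peak_count True True n = 2 ^ (n - 1)"
proof (induction n)
  case (Suc n)
  have "peak_count True True (Suc n) = (\<Sum>k\<in>{0, n}. (n choose k) *
      (peak_count True True k * peak_count True True (n - k)))"
    unfolding peak_count.simps by (intro sum.mono_neutral_cong_right) auto
  also have "\<dots> = 2 ^ n"
    using Suc.IH by (cases n) auto
  finally show ?case by simp
qed simp

section \<open>Exponential generating functions and their differential equations\<close>

definition peak_egf :: "bool \<Rightarrow> bool \<Rightarrow> real fps" where
  "peak_egf l r = Abs_fps (\<lambda>n. of_nat (peak_count l r n) / fact n)"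

text \<open>Without both flags no term of the recurrence is discarded, so it is a plain binomial
  convolution.\<close>

lemma fps_deriv_peak_egf:
  assumes "\<not> (l \<and> r)"
  shows "fps_deriv (peak_egf l r) = peak_egf l True * peak_egf True r"
proof (rule fps_ext)
  fix n
  have "fps_nth (fps_deriv (peak_egf l r)) n = real (peak_count l r (Suc n)) / fact n"
    by (simp add: peak_egf_def field_simps del: peak_count.simps of_nat_Suc)
  also have "\<dots> = (\<Sum>k\<le>n. real (n choose k) * (peak_count l True k * peak_count True r (n - k)) / fact n)"
    using assms by (auto simp: sum_divide_distrib)
  also have "\<dots> = fps_nth (peak_egf l True * peak_egf True r) n"
    unfolding fps_mult_nth peak_egf_def atLeast0AtMost
    by (intro sum.cong refl) (simp add: binomial_fact)
  finally show "fps_nth (fps_deriv (peak_egf l r)) n = fps_nth (peak_egf l True * peak_egf True r) n" .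
qed

text \<open>The summand 1 corrects the constant term, where the count is 1 instead of 1/2.\<close>

lemma peak_egf_True_True: "2 * peak_egf True True = fps_exp 2 + 1"
proof (rule fps_ext)
  fix n
  show "fps_nth (2 * peak_egf True True) n = fps_nth (fps_exp 2 + 1) n"
    by (cases n) (simp_all add: peak_egf_def peak_count_True_True numeral_fps_const field_simps)
qed

text \<open>Coefficient \<open>k\<close> of the equation determines coefficient \<open>k + 1\<close>
  of the solution from earlier ones, dividing by \<open>k + 1\<close> in characteristic
  zero.\<close>

lemma fps_linear_ode_unique:
  fixes y z w :: "'a::field_char_0 fps"
  assumes "fps_deriv y = w * y" "fps_deriv z = w * z" "fps_nth y 0 = fps_nth z 0"
  shows "y = z"
proof (rule fps_ext)
  fix n
  show "fps_nth y n = fps_nth z n"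
  proof (induction n rule: less_induct)
    case (less n)
    show ?case
    proof (cases n)
      case (Suc k)
      have "fps_nth (w * y) k = fps_nth (w * z) k"
        unfolding fps_mult_nth using less Suc by (intro sum.cong) auto
      then have "of_nat (Suc k) * fps_nth y (Suc k) = of_nat (Suc k) * fps_nth z (Suc k)"
        unfolding assms(1,2)[symmetric] by simp
      then show ?thesis using Suc by (simp del: of_nat_Suc)
    qed (use assms in simp)
  qed
qed

theorem mainTheorem6:
  shows "Abs_fps (\<lambda>n. of_nat (num_avoiding pattern_3_121_3 n) / fact n :: real) =
         1 + fps_integral0 (fps_exp 1 oo ((fps_exp 2 + 2 * fps_X - 1) / 2))"
proof -
  define h :: "real fps" where "h = (fps_exp 2 + 2 * fps_X - 1) / 2"
  have h: "h = fps_const (1/2) * (fps_exp 2 + 2 * fps_X - 1)"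
    by (simp add: h_def numeral_fps_const fps_divide_unit fps_const_inverse)
  \<comment> \<open>The chain rule for \<open>oo\<close> is applied below with this vanishing
    constant term.\<close>
  have h0: "fps_nth h 0 = 0"
    by (simp add: h)
  have h': "fps_deriv h = 2 * peak_egf True True"
    unfolding h peak_egf_True_True
    by (simp add: numeral_fps_const ring_distribs flip: mult.assoc)
  have "num_avoiding pattern_3_121_3 n = peak_count False False n" for n
    unfolding num_avoiding_def avoids_3_121_3_iff
    by (subst card_no_covered_peak) simp_all
  then have egf: "Abs_fps (\<lambda>n. of_nat (num_avoiding pattern_3_121_3 n) / fact n :: real) =
      peak_egf False False"
    by (simp only: peak_egf_def)
  let ?y = "peak_egf False True * peak_egf True False"
  have "?y = fps_exp 1 oo h"
  proof (rule fps_linear_ode_unique)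
    \<comment> \<open>By the product rule, each factor contributes one copy of
      \<open>peak_egf True True * ?y\<close>.\<close>
    show "fps_deriv ?y = (2 * peak_egf True True) * ?y"
      by (simp add: fps_deriv_peak_egf algebra_simps)
    show "fps_deriv (fps_exp 1 oo h) = (2 * peak_egf True True) * (fps_exp 1 oo h)"
      using h0 by (simp add: fps_compose_deriv h' algebra_simps)
    show "fps_nth ?y 0 = fps_nth (fps_exp 1 oo h) 0"
      by (simp add: peak_egf_def)
  qed
  then have "fps_deriv (peak_egf False False) = fps_exp 1 oo h"
    using fps_deriv_peak_egf[of False False] by simp
  \<comment> \<open>Integration loses the constant term, which is 1 for the empty
    permutation.\<close>
  then have "fps_integral0 (fps_exp 1 oo h) =
      peak_egf False False - fps_const (fps_nth (peak_egf False False) 0)"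
    using fps_integral0_deriv[of "peak_egf False False"] by simp
  also have "fps_nth (peak_egf False False) 0 = 1"
    by (simp add: peak_egf_def)
  finally show ?thesis
    unfolding egf h_def[symmetric] by simp
qed

end
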